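(* Let $\mathcal{M}=\{A_1,\dots,A_m\}\subset\mathbb{R}^{n\times n}$ be a finite set of $m$ matrices, all of which are nonsingular. Then the stabilizability radius $\tilde\rho(\mathcal{M})$ of the switched system $x(k+1)=A_{\sigma_k}x(k)$, $\sigma_k\in\{1,\dots,m\}$, satisfies $$\tilde{\rho}(\mathcal{M})\ \geq\ \tilde{\rho}_-:=\Big(\sum_{h=1}^m|\det A_h|^{-1}\Big)^{-1/n}.$$
   Context: Given a finite set $\mathcal{M}=\{A_1,\dots,A_m\}\subset\mathbb{R}^{n\times n}$, a solution of the switched system starting at $x_0\in\mathbb{R}^n$ is a sequence $(x(k))_{k\ge 0}$ with $x(0)=x_0$ and $x(k+1)=A_{\sigma_k}x(k)$ for all $k\ge 0$, for some switching signal $\sigma:\mathbb{N}\to\{1,\dots,m\}$ (which may depend on $x_0$). Let $|\cdot|$ be the Euclidean norm. For $x_0\in\mathbb{R}^n$ define $$\tilde\rho_{x_0}(\mathcal{M})=\inf\{\lambda\ge 0 : \exists\text{ a solution } x(\cdot)\text{ starting at }x_0\text{ and } M>0 \text{ such that } |x(k)|\le M\lambda^k|x_0|\ \forall k\ge 0\}.$$ The stabilizability radius of $\mathcal{M}$ is $\tilde\rho(\mathcal{M})=\sup_{x_0\in\mathbb{R}^n}\tilde\rho_{x_0}(\mathcal{M})$. It is known (from earlier work) that equivalently $$\tilde\rho(\mathcal{M})=\inf\{\lambda\ge 0:\exists M>0\text{ such that for every }x_0\in\mathbb{R}^n\text{ some solution }x(\cdot)\text{ starting at }x_0\text{ satisfies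 }|x(k)|\le M\lambda^k|x_0|\ \forall k\ge 0\}.$$ *)

theory Defs
  imports "HOL-Analysis.Analysis"
begin

text \<open>
  The switched system is given by the matrices \<open>A 1, \<dots>, A m\<close>; values of \<open>A\<close> at other indices
  are irrelevant.  The switching signal is chosen per trajectory, hence may depend on \<open>x0\<close>.
\<close>

definition switched_solution ::
    "nat \<Rightarrow> (nat \<Rightarrow> real^'n^'n) \<Rightarrow> real^'n \<Rightarrow> (nat \<Rightarrow> real^'n) \<Rightarrow> bool" where
  "switched_solution m A x0 x \<longleftrightarrow>
     x 0 = x0 \<and>
     (\<exists>\<sigma> :: nat \<Rightarrow> nat. (\<forall>k. \<sigma> k \<in> {1..m}) \<and> (\<forall>k. x (Suc k) = A (\<sigma> k) *v x k))"

definition admissible_rates ::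
    "nat \<Rightarrow> (nat \<Rightarrow> real^'n^'n) \<Rightarrow> real^'n \<Rightarrow> real set" where
  "admissible_rates m A x0 =
     {r. 0 \<le> r \<and>
        (\<exists>x M. switched_solution m A x0 x \<and> 0 < M \<and>
               (\<forall>k. norm (x k) \<le> M * r ^ k * norm x0))}"

definition stabilizability_radius_at ::
    "nat \<Rightarrow> (nat \<Rightarrow> real^'n^'n) \<Rightarrow> real^'n \<Rightarrow> real" where
  "stabilizability_radius_at m A x0 = Inf (admissible_rates m A x0)"

definition stabilizability_radius :: "nat \<Rightarrow> (nat \<Rightarrow> real^'n^'n) \<Rightarrow> real" where
  "stabilizability_radius m A = (SUP x0. stabilizability_radius_at m A x0)"

text \<open>
  For \<open>m \<ge> 1\<close> the infimum and the supremum above are taken over sets where the conditionally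
  complete order of the reals gives the genuine values: the admissible rates are nonempty and
  bounded below, and the pointwise radii are bounded above.
\<close>

lemma bdd_below_admissible_rates: "bdd_below (admissible_rates m A x0)"
  by (rule bdd_belowI[of _ 0]) (simp add: admissible_rates_def)

lemma onorm_mem_admissible_rates:
  fixes A :: "nat \<Rightarrow> real^'n^'n"
  assumes "1 \<le> m"
  shows "onorm ((*v) (A 1)) \<in> admissible_rates m A x0"
proof -
  let ?L = "onorm ((*v) (A 1))"
  define x where "x k = ((*v) (A 1) ^^ k) x0" for k
  have bl: "bounded_linear ((*v) (A 1))"
    by (rule matrix_vector_mul_bounded_linear)
  have L0: "0 \<le> ?L"
    by (rule onorm_pos_le[OF bl])
  have "switched_solution m A x0 x"
    unfolding switched_solution_def
    using assms by (intro conjI exI[of _ "\<lambda>_. 1"]) (auto simp: x_def)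
  moreover have "norm (x k) \<le> 1 * ?L ^ k * norm x0" for k
  proof (induction k)
    case 0
    show ?case by (simp add: x_def)
  next
    case (Suc k)
    have "norm (x (Suc k)) \<le> ?L * norm (x k)"
      using onorm[OF bl, of "x k"] by (simp add: x_def)
    also have "\<dots> \<le> ?L * (1 * ?L ^ k * norm x0)"
      by (rule mult_left_mono[OF Suc.IH L0])
    finally show ?case by (simp add: mult.assoc)
  qed
  ultimately show ?thesis
    unfolding admissible_rates_def using L0 zero_less_one by blast
qed

lemma bdd_above_stabilizability_radius_at:
  fixes A :: "nat \<Rightarrow> real^'n^'n"
  assumes "1 \<le> m"
  shows "bdd_above (range (stabilizability_radius_at m A))"
  unfolding stabilizability_radius_at_def
  by (rule bdd_aboveI2)
     (rule cInf_lower[OF onorm_mem_admissible_rates[OF assms] bdd_below_admissible_rates])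

end

theory Submission
  imports Defs
begin

text \<open>
  The bound is a volume count, in which the matrix \<open>A h\<close> enters only through the factor
  \<open>inverse \<bar>det (A h)\<bar>\<close> by which its inverse scales volumes (\<open>measure_matrix_vimage\<close>).  Put
  \<open>S = (\<Sum>h = 1..m. inverse \<bar>det (A h)\<bar>)\<close>.  A state that some switching signal steers in \<open>k\<close> steps
  into the ball of radius \<open>c\<close> lies in a union of preimages of that ball under products of \<open>k\<close>
  matrices.  Summing over all products, this union has volume at most \<open>S ^ k\<close> times the volume of
  the ball (\<open>measure_steerable_le\<close>).

  If trajectories decay like \<open>C * r ^ k\<close>, the ball at time \<open>k\<close> has volume proportional to
  \<open>(C * r ^ k) ^ n\<close> in dimension \<open>n\<close>, so their initial states lie in sets of volume \<open>O((S * r ^ n) ^ k)\<close>.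
  When \<open>r\<close> is smaller than the claimed bound we have \<open>S * r ^ n < 1\<close>, and these initial states form
  a null set for each \<open>C\<close> (\<open>negligible_decaying_initial_states\<close>).

  If the radius were below the claimed bound, every state would start a trajectory decaying at one
  common rate \<open>r\<close> below the bound, with a constant \<open>C\<close> that may depend on the state.  Since \<open>C\<close> may
  be taken to be a natural number, the whole space would be a countable union of null sets.
\<close>

section \<open>Linear maps scale volume by the determinant\<close>

text \<open>
  The matrix that adds coordinate \<open>n\<close> to coordinate \<open>m\<close> arises from the identity by one row
  operation.  Calling it triangular instead would presuppose a linear order on the index type.
\<close>

lemma det_transvection:
  fixes m n :: "'n::finite"
  assumes "m \<noteq> n"
  shows "det (\<chi> i j. of_bool (i = m \<and> j = n \<or> i = j) :: real^'n^'n) = 1"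
proof -
  have "(\<chi> i j. of_bool (i = m \<and> j = n \<or> i = j) :: real^'n^'n) =
        (\<chi> k. if k = m then row m (mat 1) + 1 *s row n (mat 1) else row k (mat 1))"
    using assms by (auto simp: vec_eq_iff row_def mat_def)
  then show ?thesis
    using det_row_operation[OF assms, of "mat 1 :: real^'n^'n" 1] by simp
qed

text \<open>
  The shear that adds coordinate \<open>n\<close> to coordinate \<open>m\<close> commutes with translations up to another
  translation, so it suffices to compute its effect on boxes whose \<open>n\<close>-th coordinates start at \<open>0\<close>.
\<close>

lemma measure_shear_cbox:
  fixes m n :: "'n::finite" and a b :: "real^'n"
  assumes "m \<noteq> n"
  defines "f \<equiv> \<lambda>x::real^'n. \<chi> i. if i = m then x $ m + x $ n else x $ i"
  shows "measure lebesgue (f ` cbox a b) = measure lebesgue (cbox a b)"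
proof (cases "cbox a b = {}")
  case False
  define v where "v = axis n (a $ n)"
  have box: "cbox a b = (+) v ` cbox (a - v) (b - v)"
    by (simp flip: cbox_translation)
  have f_add: "f (x + y) = f x + f y" for x y
    by (simp add: f_def vec_eq_iff)
  have "f ` cbox a b = (+) (f v) ` f ` cbox (a - v) (b - v)"
    unfolding box by (simp add: image_image f_add)
  then have "measure lebesgue (f ` cbox a b) = measure lebesgue (f ` cbox (a - v) (b - v))"
    by (simp add: measure_translation)
  also have "\<dots> = measure lebesgue (cbox (a - v) (b - v))"
    unfolding f_def using False
    by (intro measure_shear_interval[OF assms(1)]) (auto simp: box v_def)
  also have "\<dots> = measure lebesgue (cbox a b)"
    unfolding box by (rule measure_translation[symmetric])
  finally show ?thesis .
qed simp

lemma measure_transpose_coordinates_cbox: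
  fixes m n :: "'n::finite" and a b :: "real^'n"
  defines "f \<equiv> \<lambda>x::real^'n. \<chi> i. x $ Transposition.transpose m n i"
  shows "measure lebesgue (f ` cbox a b) = measure lebesgue (cbox a b)"
proof (cases "cbox a b = {}")
  case False
  have f_box: "f x \<in> cbox (f c) (f d) \<longleftrightarrow> x \<in> cbox c d" for x c d
  proof
    assume *: "f x \<in> cbox (f c) (f d)"
    have "c $ i \<le> x $ i \<and> x $ i \<le> d $ i" for i
      using *[unfolded mem_box_cart, rule_format, of "Transposition.transpose m n i"]
      by (simp add: f_def)
    then show "x \<in> cbox c d" by (simp add: mem_box_cart)
  qed (simp add: f_def mem_box_cart)
  have ff: "f (f x) = x" for x
    by (simp add: f_def)
  have image: "f ` cbox a b = cbox (f a) (f b)"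
  proof
    show "f ` cbox a b \<subseteq> cbox (f a) (f b)" using f_box by auto
    show "cbox (f a) (f b) \<subseteq> f ` cbox a b"
    proof
      fix y assume "y \<in> cbox (f a) (f b)"
      then have "f y \<in> cbox a b" using f_box[of "f y" a b] by (simp add: ff)
      then show "y \<in> f ` cbox a b" by (metis ff imageI)
    qed
  qed
  have "cbox (f a) (f b) \<noteq> {}"
    using False image by blast
  then have "measure lebesgue (cbox (f a) (f b)) =
             (\<Prod>i\<in>UNIV. (b - a) $ Transposition.transpose m n i)"
    by (simp add: content_cbox_if_cart f_def)
  also have "\<dots> = (\<Prod>i\<in>UNIV. (b - a) $ i)"
    using prod.permute[OF permutes_swap_id[of m UNIV n], of "\<lambda>i. (b - a) $ i"]
    by (simp add: o_def)
  also have "\<dots> = measure lebesgue (cbox a b)"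
    using False by (simp add: content_cbox_if_cart)
  finally show ?thesis by (simp add: image)
qed simp

text \<open>
  Both sides of the volume formula are multiplicative in the matrix, so the generators of the
  matrix monoid suffice: matrices with a zero row (whose range is a null set), diagonal matrices,
  transpositions of two coordinates, and transvections.  None of these refers to an order of the
  coordinates, which makes the argument uniform in the finite index type \<open>'n\<close>.
\<close>

lemma measure_matrix_image:
  fixes B :: "real^'n^'n"
  assumes "T \<in> lmeasurable"
  shows "(*v) B ` T \<in> lmeasurable \<and>
         measure lebesgue ((*v) B ` T) = \<bar>det B\<bar> * measure lebesgue T"
proof -
  define P where "P B \<longleftrightarrow> (\<forall>T \<in> lmeasurable. (*v) B ` T \<in> lmeasurable \<and>
      measure lebesgue ((*v) B ` T) = \<bar>det B\<bar> * measure lebesgue T)" for B :: "real^'n^'n"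
  have of_cbox: "P B" if "\<bar>det B\<bar> = 1"
      and "\<And>a b. measure lebesgue ((*v) B ` cbox a b) = measure lebesgue (cbox a b)" for B
    unfolding P_def
  proof
    fix T :: "(real^'n) set" assume T: "T \<in> lmeasurable"
    have "measure lebesgue ((*v) B ` cbox a b) = \<bar>det B\<bar> * measure lebesgue (cbox a b)" for a b
      unfolding that by (rule mult_1[symmetric])
    from measure_linear_sufficient[OF matrix_vector_mul_linear T this]
    show "(*v) B ` T \<in> lmeasurable \<and>
        measure lebesgue ((*v) B ` T) = \<bar>det B\<bar> * measure lebesgue T"
      by metis
  qed
  have "P B"
  proof (rule induct_matrix_elementary_alt[of P])
    fix B C assume B: "P B" and C: "P C"
    show "P (B ** C)"
      unfolding P_def
    proof
      fix T :: "(real^'n) set" assume T: "T \<in> lmeasurable"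
      have "(*v) (B ** C) ` T = (*v) B ` (*v) C ` T"
        by (simp add: image_image matrix_vector_mul_assoc)
      moreover have "(*v) C ` T \<in> lmeasurable"
        using C T by (simp add: P_def)
      ultimately show "(*v) (B ** C) ` T \<in> lmeasurable \<and>
          measure lebesgue ((*v) (B ** C) ` T) = \<bar>det (B ** C)\<bar> * measure lebesgue T"
        using B C T by (simp add: P_def det_mul abs_mult)
    qed
  next
    fix B :: "real^'n^'n" and i
    assume i: "row i B = 0"
    then have "(B *v x) $ i = 0" for x
      by (simp add: matrix_vector_mult_def row_def vec_eq_iff)
    then have "(*v) B ` T \<subseteq> {y. y $ i = 0}" for T by auto
    then have "negligible ((*v) B ` T)" for T
      by (rule negligible_subset[OF negligible_standard_hyperplane_cart])
    then show "P B"
      by (simp add: P_def negligible_iff_measure det_zero_row(2)[OF i])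
  next
    fix B :: "real^'n^'n"
    assume diag: "\<And>i j. i \<noteq> j \<Longrightarrow> B $ i $ j = 0"
    have "B *v x = (\<chi> k. B $ k $ k * x $ k)" for x
    proof -
      have "(\<Sum>j\<in>UNIV. B $ k $ j * x $ j) = (\<Sum>j\<in>UNIV. if j = k then B $ k $ j * x $ j else 0)" for k
        using diag by (intro sum.cong) auto
      then show ?thesis by (simp add: matrix_vector_mult_def)
    qed
    then have "(*v) B = (\<lambda>x. \<chi> k. B $ k $ k * x $ k)" by (rule ext)
    then show "P B"
      by (simp add: P_def measurable_stretch measure_stretch det_diagonal[OF diag])
  next
    fix m n :: 'n assume "m \<noteq> n"
    let ?B = "\<chi> i j. mat 1 $ i $ Transposition.transpose m n j :: real^'n^'n"
    have "?B *v x = (\<chi> i. x $ Transposition.transpose m n i)" for x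
    proof -
      have "(\<Sum>j\<in>UNIV. ?B $ i $ j * x $ j) =
          (\<Sum>j\<in>UNIV. if j = Transposition.transpose m n i then x $ j else 0)" for i
        by (intro sum.cong) (auto simp: mat_def)
      then show ?thesis by (simp add: matrix_vector_mult_def)
    qed
    then have "(*v) ?B = (\<lambda>x. \<chi> i. x $ Transposition.transpose m n i)" by (rule ext)
    moreover have "\<bar>det ?B\<bar> = 1"
      by (simp add: det_permute_columns permutes_swap_id sign_swap_id abs_mult)
    ultimately show "P ?B"
      by (intro of_cbox) (simp_all add: measure_transpose_coordinates_cbox)
  next
    fix m n :: 'n assume mn: "m \<noteq> n"
    let ?B = "\<chi> i j. of_bool (i = m \<and> j = n \<or> i = j) :: real^'n^'n"
    have "?B *v x = (\<chi> i. if i = m then x $ m + x $ n else x $ i)" for x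
    proof -
      have "(\<Sum>j\<in>UNIV. ?B $ i $ j * x $ j) =
          (\<Sum>j\<in>UNIV. (if j = i then x $ j else 0) + (if j = n then of_bool (i = m) * x $ j else 0))" for i
        using mn by (intro sum.cong) auto
      then show ?thesis by (simp add: matrix_vector_mult_def sum.distrib vec_eq_iff)
    qed
    then have "(*v) ?B = (\<lambda>x. \<chi> i. if i = m then x $ m + x $ n else x $ i)" by (rule ext)
    moreover have "\<bar>det ?B\<bar> = 1"
      by (simp only: det_transvection[OF mn] abs_one)
    ultimately show "P ?B"
      by (intro of_cbox) (simp_all only: measure_shear_cbox[OF mn])
  qed
  then show ?thesis
    using assms by (simp add: P_def)
qed

lemma
  fixes B :: "real^'n^'n"
  assumes "invertible B" and "T \<in> lmeasurable"
  shows lmeasurable_matrix_vimage: "((*v) B) -` T \<in> lmeasurable"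
    and measure_matrix_vimage:
      "measure lebesgue (((*v) B) -` T) = inverse \<bar>det B\<bar> * measure lebesgue T"
proof -
  obtain B' where B': "B ** B' = mat 1" "B' ** B = mat 1"
    using assms(1) by (auto simp: invertible_def)
  have vimage: "((*v) B) -` T = ((*v) B') ` T"
  proof
    show "((*v) B) -` T \<subseteq> ((*v) B') ` T"
    proof
      fix x assume "x \<in> ((*v) B) -` T"
      moreover have "x = B' *v (B *v x)"
        by (simp add: matrix_vector_mul_assoc B')
      ultimately show "x \<in> ((*v) B') ` T" by blast
    qed
    show "((*v) B') ` T \<subseteq> ((*v) B) -` T"
      by (auto simp: matrix_vector_mul_assoc B')
  qed
  have "det B * det B' = 1"
    using B'(1) by (metis det_I det_mul)
  then have det: "\<bar>det B'\<bar> = inverse \<bar>det B\<bar>"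
    by (metis abs_inverse inverse_unique)
  show "((*v) B) -` T \<in> lmeasurable"
    unfolding vimage using measure_matrix_image[OF assms(2)] by blast
  show "measure lebesgue (((*v) B) -` T) = inverse \<bar>det B\<bar> * measure lebesgue T"
    unfolding vimage using measure_matrix_image[OF assms(2), of B'] det by simp
qed

section \<open>Volume of the states steerable into a set\<close>

text \<open>
  The states that \<open>k\<close> steps can bring into \<open>T\<close>.  Recursing on the first step makes the total over
  all words of length \<open>k\<close> a single power \<open>S ^ k\<close>, without any reference to words.
\<close>

primrec steerable :: "nat \<Rightarrow> (nat \<Rightarrow> real^'n^'n) \<Rightarrow> (real^'n) set \<Rightarrow> nat \<Rightarrow> (real^'n) set" where
  "steerable m A T 0 = T"
| "steerable m A T (Suc k) = (\<Union>h\<in>{1..m}. ((*v) (A h)) -` steerable m A T k)"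

lemma switched_solution_steerable:
  assumes "switched_solution m A x0 x" and "x k \<in> T"
  shows "x0 \<in> steerable m A T k"
proof -
  obtain \<sigma> where \<sigma>: "x 0 = x0" "\<And>i. \<sigma> i \<in> {1..m}" "\<And>i. x (Suc i) = A (\<sigma> i) *v x i"
    using assms(1) by (auto simp: switched_solution_def)
  have "x (j + i) \<in> T \<Longrightarrow> x j \<in> steerable m A T i" for i j
  proof (induction i arbitrary: j)
    case (Suc i)
    then have "x (Suc j) \<in> steerable m A T i" by simp
    then show ?case using \<sigma>(2)[of j] \<sigma>(3)[of j] by auto
  qed simp
  from this[of 0 k] show ?thesis using assms(2) \<sigma>(1) by simp
qed

lemma lmeasurable_steerable:
  assumes "\<And>h. h \<in> {1..m} \<Longrightarrow> invertible (A h)" and "T \<in> lmeasurable"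
  shows "steerable m A T k \<in> lmeasurable"
proof (induction k)
  case (Suc k)
  then show ?case
    by (auto intro!: fmeasurable.finite_UN lmeasurable_matrix_vimage assms(1))
qed (simp add: assms(2))

text \<open>
  Each step back in time replaces a set by the union of its preimages under the \<open>A h\<close>, and
  subadditivity of the measure bounds the growth of the volume by the sum of the factors
  \<open>inverse \<bar>det (A h)\<bar>\<close>.
\<close>

lemma measure_steerable_le:
  assumes inv: "\<And>h. h \<in> {1..m} \<Longrightarrow> invertible (A h)" and T: "T \<in> lmeasurable"
  shows "measure lebesgue (steerable m A T k)
           \<le> (\<Sum>h = 1..m. inverse \<bar>det (A h)\<bar>) ^ k * measure lebesgue T"
proof (induction k)
  case (Suc k)
  let ?S = "\<Sum>h = 1..m. inverse \<bar>det (A h)\<bar>"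
  let ?U = "steerable m A T k"
  have U: "?U \<in> lmeasurable" by (rule lmeasurable_steerable[OF inv T])
  have "measure lebesgue (steerable m A T (Suc k))
          \<le> (\<Sum>h = 1..m. measure lebesgue (((*v) (A h)) -` ?U))"
    using lmeasurable_matrix_vimage[OF inv U]
    by (auto intro!: measure_UNION_le)
  also have "\<dots> = ?S * measure lebesgue ?U"
    by (simp add: measure_matrix_vimage[OF inv U] sum_distrib_right)
  also have "\<dots> \<le> ?S * (?S ^ k * measure lebesgue T)"
    by (rule mult_left_mono[OF Suc.IH]) (simp add: sum_nonneg)
  finally show ?case by (simp add: mult.assoc)
qed simp

section \<open>Decaying trajectories\<close>

text \<open>
  The initial states considered here can be steered in \<open>k\<close> steps into the ball of radius \<open>C * r ^ k\<close>
  for every \<open>k\<close>.  They are therefore covered by sets whose volumes form a geometric sequence of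
  ratio \<open>S * r ^ n < 1\<close>.  Covering by measurable sets of small volume spares any argument that the
  set of these states is itself measurable.
\<close>

lemma negligible_decaying_initial_states:
  fixes A :: "nat \<Rightarrow> real^'n^'n"
  assumes inv: "\<And>h. h \<in> {1..m} \<Longrightarrow> invertible (A h)"
    and "0 \<le> C" and "0 \<le> r"
    and contr: "(\<Sum>h = 1..m. inverse \<bar>det (A h)\<bar>) * r ^ CARD('n) < 1"
  shows "negligible {x0. \<exists>x. switched_solution m A x0 x \<and> (\<forall>k. norm (x k) \<le> C * r ^ k)}"
    (is "negligible ?E")
  unfolding negligible_outer_le
proof (intro allI impI)
  fix e :: real assume "0 < e"
  let ?S = "\<Sum>h = 1..m. inverse \<bar>det (A h)\<bar>"
  define q where "q = ?S * r ^ CARD('n)"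
  define V where "V = unit_ball_vol (real CARD('n)) * C ^ CARD('n)"
  define U where "U k = steerable m A (cball 0 (C * r ^ k)) k" for k
  have "0 \<le> q" "q < 1"
    using contr \<open>0 \<le> r\<close> by (auto simp: q_def sum_nonneg)
  then have "(\<lambda>k. q ^ k * V) \<longlonglongrightarrow> 0"
    by (intro tendsto_mult_left_zero LIMSEQ_realpow_zero)
  then obtain k where k: "q ^ k * V < e"
    using order_tendstoD(2)[OF _ \<open>0 < e\<close>] eventually_happens'[OF sequentially_bot] by metis
  have "measure lebesgue (U k) \<le> ?S ^ k * measure lebesgue (cball (0::real^'n) (C * r ^ k))"
    unfolding U_def by (rule measure_steerable_le[OF inv lmeasurable_cball])
  also have "\<dots> = ?S ^ k * (unit_ball_vol (real CARD('n)) * (C * r ^ k) ^ CARD('n))"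
    using \<open>0 \<le> C\<close> \<open>0 \<le> r\<close> by (simp add: content_cball)
  also have "\<dots> = q ^ k * V"
    by (simp add: q_def V_def power_mult_distrib mult_ac flip: power_mult)
  finally have "measure lebesgue (U k) \<le> e"
    using k by simp
  moreover have "?E \<subseteq> U k"
    by (auto simp: U_def intro!: switched_solution_steerable)
  moreover have "U k \<in> lmeasurable"
    unfolding U_def by (rule lmeasurable_steerable[OF inv lmeasurable_cball])
  ultimately show "\<exists>T. ?E \<subseteq> T \<and> T \<in> lmeasurable \<and> measure lebesgue T \<le> e"
    by blast
qed

text \<open>
  A rate witnessing the infimum at \<open>x0\<close> may be enlarged to \<open>r\<close>, which no longer depends on \<open>x0\<close>,
  and the constant to a natural number that also absorbs the factor \<open>norm x0\<close>.
\<close>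

lemma decaying_solution_of_stabilizability_radius_less:
  fixes A :: "nat \<Rightarrow> real^'n^'n"
  assumes "1 \<le> m" and "stabilizability_radius m A < r"
  obtains x and N :: nat
    where "0 \<le> r" "switched_solution m A x0 x" "\<And>k. norm (x k) \<le> real N * r ^ k"
proof -
  have "stabilizability_radius_at m A x0 \<le> stabilizability_radius m A"
    unfolding stabilizability_radius_def
    by (rule cSUP_upper[OF UNIV_I bdd_above_stabilizability_radius_at[OF assms(1)]])
  then have "Inf (admissible_rates m A x0) < r"
    using assms(2) by (simp add: stabilizability_radius_at_def)
  then obtain s where s: "s \<in> admissible_rates m A x0" "s < r"
    using cInf_lessD[of "admissible_rates m A x0" r] onorm_mem_admissible_rates[OF assms(1)] by blast
  then obtain x M where x: "switched_solution m A x0 x" "0 < M" "0 \<le> s"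
    "\<And>k. norm (x k) \<le> M * s ^ k * norm x0"
    by (auto simp: admissible_rates_def)
  obtain N :: nat where N: "M * norm x0 \<le> real N"
    using real_arch_simple by blast
  have "norm (x k) \<le> real N * r ^ k" for k
  proof -
    have "norm (x k) \<le> (M * norm x0) * s ^ k"
      using x(4)[of k] by (simp add: mult_ac)
    also have "\<dots> \<le> real N * r ^ k"
      using N x(2,3) s(2) by (intro mult_mono power_mono) auto
    finally show ?thesis .
  qed
  moreover have "0 \<le> r" using x(3) s(2) by simp
  ultimately show thesis by (intro that[OF _ x(1)])
qed

theorem theorem2:
  fixes A :: "nat \<Rightarrow> real^'n^'n" and m :: nat
  assumes "1 \<le> m"
    and "\<And>h. h \<in> {1..m} \<Longrightarrow> invertible (A h)"
  shows "stabilizability_radius m A \<ge>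
           (\<Sum>h = 1..m. inverse \<bar>det (A h)\<bar>) powr (- 1 / real CARD('n))"
proof (rule ccontr)
  let ?S = "\<Sum>h = 1..m. inverse \<bar>det (A h)\<bar>"
  let ?n = "CARD('n)"
  assume "\<not> ?thesis"
  then obtain r where r: "stabilizability_radius m A < r" "r < ?S powr (- 1 / real ?n)"
    using dense not_le by metis
  have S: "0 < ?S"
    using assms by (intro sum_pos) (auto simp: invertible_det_nz)
  define E where "E N = {x0. \<exists>x. switched_solution m A x0 x \<and>
    (\<forall>k. norm (x k) \<le> real N * r ^ k)}" for N
  have cover: "(\<Union>N. E N) = UNIV"
  proof -
    have "\<exists>N. x0 \<in> E N" for x0
      by (rule decaying_solution_of_stabilizability_radius_less[OF assms(1) r(1), of x0])
         (auto simp: E_def)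
    then show ?thesis by blast
  qed
  have "0 \<le> r"
    by (rule decaying_solution_of_stabilizability_radius_less[OF assms(1) r(1)])
  have "r ^ ?n < (?S powr (- 1 / real ?n)) ^ ?n"
    using r(2) \<open>0 \<le> r\<close> by (intro power_strict_mono) auto
  also have "\<dots> = ?S powr (- 1)"
    using S by (simp add: powr_powr flip: powr_realpow)
  also have "\<dots> = inverse ?S"
    using S by (simp add: powr_minus)
  finally have "?S * r ^ ?n < 1"
    using S by (simp add: field_simps)
  then have "negligible (E N)" for N
    unfolding E_def using assms(2) \<open>0 \<le> r\<close>
    by (intro negligible_decaying_initial_states) auto
  then have "negligible (\<Union>N. E N)"
    by (rule negligible_Union_nat)
  then show False
    using cover by simp
qed

end
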